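(* Let $\mathcal S$ be an arbitrary (not necessarily finite) set with $|\mathcal S|\ge 2$. Let $\mathfrak M$ be the set of all media on $\mathcal S$ and $\mathfrak G$ the set of all mediatic graphs on $\mathcal S$ (that is, with vertex set $\mathcal S$). Then there exists a bijection $\mathfrak f:\mathfrak M\to\mathfrak G$ such that, for every $\mathcal M\in\mathfrak M$, $\mathfrak f(\mathcal M)$ is the graph of $\mathcal M$, and, for all $\mathcal M\in\mathfrak M$ and $G\in\mathfrak G$, $G=\mathfrak f(\mathcal M)$ is the graph of $\mathcal M$ if and only if $\mathcal M$ is the medium of the mediatic graph $G$.
   Context: Token systems. Let $\mathcal S$ be a set of states with $|\mathcal S|\ge 2$. A token is a function $\tau:\mathcal S\to\mathcal S$, written $S\mapsto S\tau$, different from the identity function $\tau_0$ on $\mathcal S$; compositions are written $S\tau_1\tau_2\cdots\tau_n=\tau_n[\cdots\tau_2[\tau_1(S)]\cdots]$. A token system is a pair $(\mathcal S,\mathcal T)$ with $\mathcal T\ne\emptyset$ a set of tokens on $\mathcal S$. For distinct states $S,V$, $V$ is adjacent to $S$ if $S\tau=V$ for some $\tau\in\mathcal T$. A token $\tilde\tau\in\mathcal T$ is a reverse of a token $\tau$ if for any two adjacent states $S,V$ (distinct states, one of which is adjacent to the other) we have $S\tau=V\iff V\tilde\tau=S$. A token has at most one reverse. Messages. A message is a string $\boldsymbol m=\tau_1\ldots\tau_n$ of tokens of $\mathcal T$; it defines the function $S\mapsto S\boldsymbol m=S\tau_1\cdots\tau_n$, and produces $V$ from $S$ if $S\boldsymbol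 m=V$. It is ineffective for $S$ if $S\boldsymbol m=S$; stepwise effective for $S$ if $S\tau_1\cdots\tau_k\ne S\tau_0\cdots\tau_{k-1}$ for $1\le k\le n$; a return (for $S$) if it is both stepwise effective and ineffective for $S$; consistent if it does not contain both a token and its reverse; concise for $S$ if it is consistent, stepwise effective for $S$, and no token occurs in it more than once; vacuous if $\{1,\ldots,n\}$ can be partitioned into pairs $\{i,j\}$ such that $\tau_i,\tau_j$ are mutual reverses. A token system $(\mathcal S,\mathcal T)$ is a medium (on $\mathcal S$) if: [Ma] for any two distinct states $S,V$ there is a concise message producing $V$ from $S$; [Mb] any return message is vacuous. The graph of a medium $(\mathcal S,\mathcal T)$ is the loopless graph $(\mathcal S,E)$ in which, for distinct $S,T\in\mathcal S$, $\{S,T\}\in E\iff(\exists\tau\in\mathcal T)(S\tau=T)$. Like relation. For a graph $G=(V,E)$ let $\vec E=\{ST\mid\{S,T\}\in E\}$ be the set of its arcs (each edge gives the two arcs $ST$ and $TS$), and let $\delta$ be the graph distance. The like relation $\mathfrak L$ is the relation on $\vec E$ defined, for $\{S,T\},\{P,Q\}\in E$, by $$ST\,\mathfrak L\,PQ\iff \delta(S,P)+1=\delta(T,Q)+1=\delta(S,Q)=\delta(T,P).$$ A graph (without loops) is mediatic if it is connected, bipartite, and its like relation $\mathfrak L$ is transitive. The medium of a mediatic graph $G=(\mathcal S,E)$ is the pair $(\mathcal S,\mathcal T)$ with $\mathcal T=\{\tau_{ST}\mid ST\in\vec E\}$, where for each $ST\in\vec E$ the function $\tau_{ST}:\mathcal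 S\to\mathcal S$ is given by $P\tau_{ST}=Q$ if $PQ\in\vec E$ and $ST\,\mathfrak L\,PQ$, and $P\tau_{ST}=P$ if there is no such $Q$. *)

theory Defs
  imports Main "HOL-Library.FuncSet" "HOL-Library.Disjoint_Sets"
begin

section \<open>Token systems and media\<close>

text \<open>
  The state space is a carrier set \<open>S\<close>. Functions from \<open>S\<close> to \<open>S\<close> are the elements of
  \<open>S \<rightarrow>\<^sub>E S\<close>: they are \<open>undefined\<close> outside \<open>S\<close>, so that HOL equality of tokens is
  equality of functions on \<open>S\<close>. A token system or medium is a pair \<open>(S, T)\<close>.
\<close>

type_synonym 'a token = "'a \<Rightarrow> 'a"

definition is_token :: "'a set \<Rightarrow> 'a token \<Rightarrow> bool" where
  "is_token S \<tau> \<longleftrightarrow> \<tau> \<in> S \<rightarrow>\<^sub>E S \<and> \<tau> \<noteq> (\<lambda>s\<in>S. s)"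

definition token_system :: "'a set \<Rightarrow> 'a token set \<Rightarrow> bool" where
  "token_system S T \<longleftrightarrow>
     (\<exists>s\<in>S. \<exists>v\<in>S. s \<noteq> v) \<and> T \<noteq> {} \<and> (\<forall>\<tau>\<in>T. is_token S \<tau>)"

text \<open>\<open>adjacent_to S T s v\<close>: the state \<open>v\<close> is adjacent to the state \<open>s\<close>.\<close>

definition adjacent_to :: "'a set \<Rightarrow> 'a token set \<Rightarrow> 'a \<Rightarrow> 'a \<Rightarrow> bool" where
  "adjacent_to S T s v \<longleftrightarrow> s \<in> S \<and> v \<in> S \<and> s \<noteq> v \<and> (\<exists>\<tau>\<in>T. \<tau> s = v)"

text \<open>\<open>is_reverse S T \<tau>' \<tau>\<close>: the token \<open>\<tau>'\<close> is a reverse of the token \<open>\<tau>\<close>.\<close>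

definition is_reverse :: "'a set \<Rightarrow> 'a token set \<Rightarrow> 'a token \<Rightarrow> 'a token \<Rightarrow> bool" where
  "is_reverse S T \<tau>' \<tau> \<longleftrightarrow> \<tau>' \<in> T \<and> \<tau> \<in> T \<and>
     (\<forall>s\<in>S. \<forall>v\<in>S. adjacent_to S T s v \<or> adjacent_to S T v s \<longrightarrow>
        (\<tau> s = v \<longleftrightarrow> \<tau>' v = s))"

text \<open>Messages are lists of tokens, applied from left to right.\<close>

definition is_message :: "'a token set \<Rightarrow> 'a token list \<Rightarrow> bool" where
  "is_message T m \<longleftrightarrow> set m \<subseteq> T"

definition run :: "'a token list \<Rightarrow> 'a \<Rightarrow> 'a" where
  "run m s = fold (\<lambda>\<tau> x. \<tau> x) m s"

definition stepwise_effective :: "'a token list \<Rightarrow> 'a \<Rightarrow> bool" where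
  "stepwise_effective m s \<longleftrightarrow>
     (\<forall>k\<in>{1..length m}. run (take k m) s \<noteq> run (take (k - 1) m) s)"

definition is_return :: "'a token list \<Rightarrow> 'a \<Rightarrow> bool" where
  "is_return m s \<longleftrightarrow> stepwise_effective m s \<and> run m s = s"

text \<open>A message containing a token that is its own reverse is not consistent.\<close>

definition consistent :: "'a set \<Rightarrow> 'a token set \<Rightarrow> 'a token list \<Rightarrow> bool" where
  "consistent S T m \<longleftrightarrow> \<not> (\<exists>\<tau>\<in>set m. \<exists>\<tau>'\<in>set m. is_reverse S T \<tau>' \<tau>)"

definition concise :: "'a set \<Rightarrow> 'a token set \<Rightarrow> 'a token list \<Rightarrow> 'a \<Rightarrow> bool" where
  "concise S T m s \<longleftrightarrow> consistent S T m \<and> stepwise_effective m s \<and> distinct m"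

definition vacuous :: "'a set \<Rightarrow> 'a token set \<Rightarrow> 'a token list \<Rightarrow> bool" where
  "vacuous S T m \<longleftrightarrow>
     (\<exists>P. partition_on {..<length m} P \<and>
        (\<forall>p\<in>P. \<exists>i j. p = {i, j} \<and> i \<noteq> j \<and>
           is_reverse S T (m ! i) (m ! j) \<and> is_reverse S T (m ! j) (m ! i)))"

definition medium :: "'a set \<Rightarrow> 'a token set \<Rightarrow> bool" where
  "medium S T \<longleftrightarrow> token_system S T \<and>
     (\<forall>s\<in>S. \<forall>v\<in>S. s \<noteq> v \<longrightarrow>
        (\<exists>m. is_message T m \<and> concise S T m s \<and> run m s = v)) \<and>
     (\<forall>m. \<forall>s\<in>S. is_message T m \<and> is_return m s \<longrightarrow> vacuous S T m)"

definition media_on :: "'a set \<Rightarrow> ('a set \<times> 'a token set) set" where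
  "media_on S = {(S, T) | T. medium S T}"


section \<open>Mediatic graphs\<close>

text \<open>A loopless graph is a pair \<open>(V, E)\<close> in which \<open>E\<close> consists of two-element subsets of \<open>V\<close>.\<close>

definition loopless_graph :: "'a set \<Rightarrow> 'a set set \<Rightarrow> bool" where
  "loopless_graph V E \<longleftrightarrow> (\<forall>e\<in>E. \<exists>u\<in>V. \<exists>v\<in>V. u \<noteq> v \<and> e = {u, v})"

definition arcs :: "'a set set \<Rightarrow> ('a \<times> 'a) set" where
  "arcs E = {(u, v). {u, v} \<in> E}"

definition graph_connected :: "'a set \<Rightarrow> 'a set set \<Rightarrow> bool" where
  "graph_connected V E \<longleftrightarrow> (\<forall>u\<in>V. \<forall>v\<in>V. (u, v) \<in> (arcs E)\<^sup>*)"

definition graph_bipartite :: "'a set \<Rightarrow> 'a set set \<Rightarrow> bool" where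
  "graph_bipartite V E \<longleftrightarrow>
     (\<exists>A B. A \<union> B = V \<and> A \<inter> B = {} \<and> (\<forall>e\<in>E. \<exists>a\<in>A. \<exists>b\<in>B. e = {a, b}))"

text \<open>
  The graph distance: \<open>(u, v) \<in> arcs E ^^ n\<close> says that there is a walk of length \<open>n\<close> from \<open>u\<close>
  to \<open>v\<close>. The value is meaningful only if \<open>u\<close> and \<open>v\<close> lie in the same component; below the
  distance only matters for connected graphs.
\<close>

definition graph_dist :: "'a set set \<Rightarrow> 'a \<Rightarrow> 'a \<Rightarrow> nat" where
  "graph_dist E u v = (LEAST n. (u, v) \<in> arcs E ^^ n)"

definition like_rel :: "'a set set \<Rightarrow> (('a \<times> 'a) \<times> ('a \<times> 'a)) set" where
  "like_rel E = {((s, t), (p, q)). (s, t) \<in> arcs E \<and> (p, q) \<in> arcs E \<and>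
     graph_dist E s p + 1 = graph_dist E t q + 1 \<and>
     graph_dist E t q + 1 = graph_dist E s q \<and>
     graph_dist E s q = graph_dist E t p}"

definition mediatic_graph :: "'a set \<Rightarrow> 'a set set \<Rightarrow> bool" where
  "mediatic_graph V E \<longleftrightarrow> loopless_graph V E \<and> graph_connected V E \<and>
     graph_bipartite V E \<and> trans (like_rel E)"

definition mediatic_graphs_on :: "'a set \<Rightarrow> ('a set \<times> 'a set set) set" where
  "mediatic_graphs_on S = {(S, E) | E. mediatic_graph S E}"


section \<open>The graph of a medium and the medium of a mediatic graph\<close>

text \<open>
  \<open>is_graph_of M G\<close>: \<open>G\<close> is the graph of \<open>M\<close>. Since the edges of a loopless graph are
  two-element sets of vertices, at most one \<open>G\<close> satisfies this for a given \<open>M\<close>.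
\<close>

fun is_graph_of :: "'a set \<times> 'a token set \<Rightarrow> 'a set \<times> 'a set set \<Rightarrow> bool" where
  "is_graph_of (S, T) (V, E) \<longleftrightarrow> V = S \<and> loopless_graph V E \<and>
     (\<forall>s\<in>S. \<forall>t\<in>S. s \<noteq> t \<longrightarrow> ({s, t} \<in> E \<longleftrightarrow> (\<exists>\<tau>\<in>T. \<tau> s = t)))"

text \<open>
  The definite description is justified in mediatic graphs: there the like relation is an
  equivalence relation on arcs, and like arcs with the same tail are equal.
\<close>

definition graph_token :: "'a set \<Rightarrow> 'a set set \<Rightarrow> 'a \<times> 'a \<Rightarrow> 'a token" where
  "graph_token S E st = (\<lambda>p\<in>S.
     if \<exists>q. (p, q) \<in> arcs E \<and> (st, (p, q)) \<in> like_rel E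
     then (THE q. (p, q) \<in> arcs E \<and> (st, (p, q)) \<in> like_rel E)
     else p)"

fun medium_of_graph :: "'a set \<times> 'a set set \<Rightarrow> 'a set \<times> 'a token set" where
  "medium_of_graph (S, E) = (S, graph_token S E ` arcs E)"

end

theory Submission imports Defs begin

text \<open>
  In a mediatic graph the arcs like \<open>ab\<close> are the arcs that leave the set of vertices closer to
  \<open>a\<close> than to \<open>b\<close>. A closed walk crosses such a cut equally often in both directions, so its
  tokens pair off with their reverses; along a shortest path no cut is crossed twice, so shortest
  paths give concise messages. Transitivity of the like relation is needed only to make the
  tokens well defined.

  In a medium, vacuity of returns says that the net number of occurrences of a token in a stepwise
  effective message depends only on the two end points. Hence the concise messages are exactly the
  shortest ones, and closed walks are even. A token that moves \<open>s\<close> cannot have its reverse in a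
  concise message starting at \<open>s\<close>; comparing lengths, two arcs are like iff the same token
  induces them, so the like relation is transitive and the medium is recovered from its graph.
\<close>

section \<open>Messages as walks\<close>

lemma run_Nil [simp]: "run [] s = s"
  and run_Cons [simp]: "run (\<tau> # m) s = run m (\<tau> s)"
  by (simp_all add: run_def)

lemma run_append [simp]: "run (m @ n) s = run n (run m s)"
  by (simp add: run_def)

lemma stepwise_effective_Nil [simp]: "stepwise_effective [] s"
  by (simp add: stepwise_effective_def)

lemma stepwise_effective_iff:
  "stepwise_effective m s \<longleftrightarrow> (\<forall>k<length m. run (take (Suc k) m) s \<noteq> run (take k m) s)"
  unfolding stepwise_effective_def image_Suc_lessThan[symmetric] by auto

lemma stepwise_effective_Cons [simp]:
  "stepwise_effective (\<tau> # m) s \<longleftrightarrow> \<tau> s \<noteq> s \<and> stepwise_effective m (\<tau> s)"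
  by (simp add: stepwise_effective_iff All_less_Suc2)

lemma stepwise_effective_append [simp]:
  "stepwise_effective (m @ n) s \<longleftrightarrow> stepwise_effective m s \<and> stepwise_effective n (run m s)"
  by (induction m arbitrary: s) auto

text \<open>Built so that walks decompose along \<open>Cons\<close> and compose under append: a
  return for \<open>s\<close> is a walk from \<open>s\<close> back to \<open>s\<close>, and
  inductions on messages need no step indices.\<close>

definition walk :: "'a token set \<Rightarrow> 'a \<Rightarrow> 'a token list \<Rightarrow> 'a \<Rightarrow> bool" where
  "walk T s m v \<longleftrightarrow> is_message T m \<and> stepwise_effective m s \<and> run m s = v"

lemma walk_Nil [simp]: "walk T s [] v \<longleftrightarrow> s = v"
  by (simp add: walk_def is_message_def)

lemma walk_Cons [simp]: "walk T s (\<tau> # m) v \<longleftrightarrow> \<tau> \<in> T \<and> \<tau> s \<noteq> s \<and> walk T (\<tau> s) m v"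
  by (auto simp: walk_def is_message_def)

lemma walk_append: "walk T s (m @ n) v \<longleftrightarrow> (\<exists>u. walk T s m u \<and> walk T u n v)"
  by (auto simp: walk_def is_message_def)

lemma walk_tokens: "walk T s m v \<Longrightarrow> set m \<subseteq> T"
  by (simp add: walk_def is_message_def)

lemma medium_iff:
  "medium S T \<longleftrightarrow> token_system S T \<and>
     (\<forall>s\<in>S. \<forall>v\<in>S. s \<noteq> v \<longrightarrow> (\<exists>m. walk T s m v \<and> consistent S T m \<and> distinct m)) \<and>
     (\<forall>m. \<forall>s\<in>S. walk T s m s \<longrightarrow> vacuous S T m)"
  unfolding medium_def walk_def concise_def is_return_def by blast

section \<open>Reverses and vacuous messages\<close>

lemma is_reverse_sym: "is_reverse S T \<tau>' \<tau> \<Longrightarrow> is_reverse S T \<tau> \<tau>'"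
  unfolding is_reverse_def by blast

text \<open>Where a reverse of \<open>\<tau>\<close> moves \<open>v\<close>, the adjacency of
  \<open>v\<close> and its image lets the defining equivalence force any other reverse to take the
  same value. By symmetry the two can differ nowhere on \<open>S\<close>, and both are
  \<open>undefined\<close> outside.\<close>

lemma is_reverse_unique:
  assumes "token_system S T" and a: "is_reverse S T \<alpha> \<tau>" and b: "is_reverse S T \<beta> \<tau>"
  shows "\<alpha> = \<beta>"
proof -
  have ext: "\<alpha> \<in> S \<rightarrow>\<^sub>E S" "\<beta> \<in> S \<rightarrow>\<^sub>E S"
    using assms unfolding token_system_def is_token_def is_reverse_def by auto
  have half: "\<mu> v = \<nu> v"
    if "is_reverse S T \<mu> \<tau>" "is_reverse S T \<nu> \<tau>" "v \<in> S" "\<mu> v \<in> S" "\<mu> v \<noteq> v" for \<mu> \<nu> v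
  proof -
    have "adjacent_to S T v (\<mu> v)"
      using that unfolding adjacent_to_def is_reverse_def by metis
    then show ?thesis
      using that unfolding is_reverse_def by metis
  qed
  show ?thesis
  proof (rule PiE_ext[OF ext])
    fix v assume "v \<in> S"
    moreover from this have "\<alpha> v \<in> S" "\<beta> v \<in> S"
      using ext by auto
    ultimately show "\<alpha> v = \<beta> v"
      using half[OF a b] half[OF b a] by metis
  qed
qed

lemma count_list_card: "count_list m x = card {i. i < length m \<and> m ! i = x}"
  by (simp add: count_list_eq_length_filter length_filter_conv_card eq_commute)

lemma count_list_le_1: "distinct m \<Longrightarrow> count_list m x \<le> 1"
  by (induction m) auto

lemma vacuous_even_length:
  assumes "vacuous S T m"
  shows "even (length m)"
proof -
  obtain P where P: "partition_on {..<length m} P" "\<forall>p\<in>P. \<exists>i j. p = {i, j} \<and> i \<noteq> j"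
    using assms unfolding vacuous_def by fast
  have "2 * card P = card (\<Union>P)"
  proof (rule card_partition)
    show "finite P" "finite (\<Union>P)"
      using P(1) finite_elements partition_onD1 by (blast, metis finite_lessThan)
    show "card p = 2" if "p \<in> P" for p
      using P(2) that by fastforce
    show "p \<inter> q = {}" if "p \<in> P" "q \<in> P" "p \<noteq> q" for p q
      using partition_onD2[OF P(1)] that by (auto simp: disjoint_def)
  qed
  also have "\<dots> = length m"
    using P(1) by (metis card_lessThan partition_onD1)
  finally show ?thesis
    by (metis dvd_triv_left)
qed

text \<open>Sending a position to its partner in the pairing is injective, and by uniqueness of
  reverses it carries the occurrences of \<open>\<tau>\<close> into those of
  \<open>\<tau>'\<close>.\<close>

lemma vacuous_count_le:
  assumes ts: "token_system S T" and vac: "vacuous S T m" and rev: "is_reverse S T \<tau>' \<tau>"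
  shows "count_list m \<tau> \<le> count_list m \<tau>'"
proof -
  obtain P where P: "partition_on {..<length m} P"
    "\<forall>p\<in>P. \<exists>i j. p = {i, j} \<and> i \<noteq> j \<and>
           is_reverse S T (m ! i) (m ! j) \<and> is_reverse S T (m ! j) (m ! i)"
    using vac unfolding vacuous_def by fast
  have "\<exists>j. {i, j} \<in> P \<and> i \<noteq> j \<and> is_reverse S T (m ! j) (m ! i)" if "i < length m" for i
  proof -
    have "i \<in> \<Union>P"
      using partition_onD1[OF P(1)] that by auto
    then obtain p where p: "p \<in> P" "i \<in> p" by blast
    obtain a b where "p = {a, b}" "a \<noteq> b" "is_reverse S T (m ! a) (m ! b)"
        "is_reverse S T (m ! b) (m ! a)"
      using P(2) p(1) by blast
    then show ?thesis
      using p by (metis doubleton_eq_iff insert_iff singletonD)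
  qed
  then obtain g where g: "\<And>i. i < length m \<Longrightarrow>
      {i, g i} \<in> P \<and> i \<noteq> g i \<and> is_reverse S T (m ! g i) (m ! i)"
    by metis
  have "g i < length m" if "i < length m" for i
    using g[OF that] partition_onD1[OF P(1)] by blast
  moreover have "m ! g i = \<tau>'" if "i < length m" "m ! i = \<tau>" for i
    using g[OF that(1)] is_reverse_unique[OF ts] rev that(2) by blast
  moreover have "inj_on g {..<length m}"
  proof (rule inj_onI)
    fix i j assume ij: "i \<in> {..<length m}" "j \<in> {..<length m}" "g i = g j"
    then have "{i, g i} \<in> P" "{j, g j} \<in> P" "g i \<in> {i, g i} \<inter> {j, g j}"
      using g[of i] g[of j] by auto
    then have "{i, g i} = {j, g j}"
      using disjointD[OF partition_onD2[OF P(1)]] by (metis empty_iff)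
    then show "i = j"
      using ij by (metis doubleton_eq_iff)
  qed
  ultimately show ?thesis
    unfolding count_list_card by (intro card_inj_on_le[of g]) (auto intro: inj_on_subset)
qed

lemma vacuous_count_eq:
  assumes "token_system S T" "vacuous S T m" "is_reverse S T \<tau>' \<tau>"
  shows "count_list m \<tau> = count_list m \<tau>'"
  using vacuous_count_le assms is_reverse_sym by (metis le_antisym)

text \<open>A combinatorial converse to the counting lemmas: colours matched by a fixed-point-free
  involution and equally frequent can be paired off. It is stated for an arbitrary finite index set
  because the induction deletes two positions at a time.\<close>

lemma balanced_pairing:
  fixes c :: "'i \<Rightarrow> 'b" and r :: "'b \<Rightarrow> 'b"
  assumes "finite I" and "\<And>i. i \<in> I \<Longrightarrow> r (r (c i)) = c i" and "\<And>i. i \<in> I \<Longrightarrow> r (c i) \<noteq> c i"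
    and "\<And>i. i \<in> I \<Longrightarrow> card {j \<in> I. c j = c i} = card {j \<in> I. c j = r (c i)}"
  shows "\<exists>P. partition_on I P \<and> (\<forall>p\<in>P. \<exists>i\<in>I. \<exists>j\<in>I. p = {i, j} \<and> i \<noteq> j \<and> c j = r (c i))"
  using assms
proof (induction I rule: finite_psubset_induct)
  case (psubset I)
  show ?case
  proof (cases "I = {}")
    case True
    then show ?thesis
      by (intro exI[of _ "{}"]) (auto simp: partition_on_def)
  next
    case False
    then obtain i where i: "i \<in> I" by blast
    then have "card {j \<in> I. c j = c i} \<noteq> 0"
      using psubset.hyps by auto
    then have "{j \<in> I. c j = r (c i)} \<noteq> {}"
      using psubset.prems(3)[OF i] by (metis card.empty)
    then obtain j where j: "j \<in> I" "c j = r (c i)" by blast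
    have ij: "i \<noteq> j"
      using j psubset.prems(2)[OF i] by metis
    define J where "J = I - {i, j}"
    have split: "card {k \<in> I. c k = x} =
        card {k \<in> J. c k = x} + (if x = c i then 1 else 0) + (if x = c j then 1 else 0)" for x
    proof -
      have "{k \<in> I. c k = x} = {k \<in> J. c k = x} \<union>
          ((if x = c i then {i} else {}) \<union> (if x = c j then {j} else {}))"
        using i j by (auto simp: J_def)
      also have "card \<dots> = card {k \<in> J. c k = x} +
          card ((if x = c i then {i} else {}) \<union> (if x = c j then {j} else {}))"
        using psubset.hyps by (intro card_Un_disjoint) (auto simp: J_def)
      finally show ?thesis using ij by auto
    qed
    have "J \<subset> I" using i by (auto simp: J_def)
    moreover have "card {l \<in> J. c l = c k} = card {l \<in> J. c l = r (c k)}" if "k \<in> J" for k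
    proof -
      have k: "k \<in> I" using that by (simp add: J_def)
      \<comment> \<open>The involution exchanges the two colours removed, so the corrections in
        \<open>split\<close> for \<open>c k\<close> and for \<open>r (c k)\<close> have the same
        sum, and balance survives in \<open>J\<close>.\<close>
      have "r (c k) = c i \<longleftrightarrow> c k = c j" "r (c k) = c j \<longleftrightarrow> c k = c i"
        using j psubset.prems(1)[OF i] psubset.prems(1)[OF k] by metis+
      then show ?thesis
        using psubset.prems(3)[OF k] unfolding split by auto
    qed
    ultimately obtain P where P: "partition_on J P"
      "\<forall>p\<in>P. \<exists>i\<in>J. \<exists>j\<in>J. p = {i, j} \<and> i \<noteq> j \<and> c j = r (c i)"
      using psubset.IH[of J] psubset.prems(1,2) by (auto simp: J_def)
    have "partition_on I (insert {i, j} P)"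
    proof (rule partition_onI)
      show "\<Union>(insert {i, j} P) = I"
        using partition_onD1[OF P(1)] i j by (auto simp: J_def)
      show "disjnt p q" if "p \<in> insert {i, j} P" "q \<in> insert {i, j} P" "p \<noteq> q" for p q
        using that partition_onD1[OF P(1)] partition_onD2[OF P(1)]
        by (auto simp: J_def disjoint_def disjnt_def)
      show "{} \<notin> insert {i, j} P"
        using partition_onD3[OF P(1)] by auto
    qed
    moreover have "\<forall>p\<in>insert {i, j} P. \<exists>i\<in>I. \<exists>j\<in>I. p = {i, j} \<and> i \<noteq> j \<and> c j = r (c i)"
      using P(2) i j ij unfolding J_def by blast
    ultimately show ?thesis by blast
  qed
qed

section \<open>Distances\<close>

lemma arcs_sym: "(u, v) \<in> arcs E \<longleftrightarrow> (v, u) \<in> arcs E"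
  by (simp add: arcs_def insert_commute)

lemma walk_arcs_sym: "(u, v) \<in> arcs E ^^ n \<longleftrightarrow> (v, u) \<in> arcs E ^^ n"
proof -
  have "(v, u) \<in> arcs E ^^ n" if "(u, v) \<in> arcs E ^^ n" for u v
    using that
  proof (induction n arbitrary: v)
    case (Suc n)
    then obtain w where "(u, w) \<in> arcs E ^^ n" "(w, v) \<in> arcs E"
      by auto
    then show ?case
      using Suc.IH arcs_sym by (metis relpow_Suc_I2)
  qed auto
  then show ?thesis by blast
qed

lemma graph_dist_commute: "graph_dist E u v = graph_dist E v u"
  unfolding graph_dist_def by (subst walk_arcs_sym) (rule refl)

lemma graph_dist_le: "(u, v) \<in> arcs E ^^ n \<Longrightarrow> graph_dist E u v \<le> n"
  unfolding graph_dist_def by (rule Least_le)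

lemma graph_dist_self [simp]: "graph_dist E u u = 0"
  using graph_dist_le[of u u 0 E] by simp

locale connected_graph =
  fixes V :: "'a set" and E :: "'a set set"
  assumes loopless: "loopless_graph V E" and connected: "graph_connected V E"
begin

abbreviation \<delta> :: "'a \<Rightarrow> 'a \<Rightarrow> nat" where "\<delta> \<equiv> graph_dist E"

lemma arcD: "(u, v) \<in> arcs E \<Longrightarrow> u \<in> V \<and> v \<in> V \<and> u \<noteq> v"
  using loopless unfolding loopless_graph_def arcs_def by (auto simp: doubleton_eq_iff)

text \<open>Connectedness makes the \<open>LEAST\<close> in \<open>graph_dist\<close> an attained
  minimum.\<close>

lemma dist_walk: "u \<in> V \<Longrightarrow> v \<in> V \<Longrightarrow> (u, v) \<in> arcs E ^^ \<delta> u v"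
  using connected unfolding graph_connected_def graph_dist_def
  by (metis LeastI_ex rtrancl_power)

lemma dist_eq_0: "u \<in> V \<Longrightarrow> v \<in> V \<Longrightarrow> \<delta> u v = 0 \<longleftrightarrow> u = v"
  using dist_walk by fastforce

lemma dist_triangle: "u \<in> V \<Longrightarrow> v \<in> V \<Longrightarrow> w \<in> V \<Longrightarrow> \<delta> u w \<le> \<delta> u v + \<delta> v w"
  using dist_walk by (metis graph_dist_le relcomp.relcompI relpow_add)

lemma dist_arc: "(u, v) \<in> arcs E \<Longrightarrow> \<delta> u v = 1"
  using graph_dist_le[of u v 1 E] dist_eq_0[of u v] arcD[of u v] by fastforce

lemma dist_arc_le: "(u, v) \<in> arcs E \<Longrightarrow> w \<in> V \<Longrightarrow> \<delta> w v \<le> \<delta> w u + 1"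
  using dist_triangle[of w u v] dist_arc arcD by fastforce

end

section \<open>The medium of a mediatic graph\<close>

locale mediatic = connected_graph +
  assumes bipartite: "graph_bipartite V E" and like_trans: "trans (like_rel E)"
begin

section \<open>Parity of distances and the like relation as crossing a cut\<close>

lemma parity:
  obtains A where "\<And>u v n. (u, v) \<in> arcs E ^^ n \<Longrightarrow> even n \<longleftrightarrow> (u \<in> A \<longleftrightarrow> v \<in> A)"
proof -
  obtain A B where AB: "A \<inter> B = {}" "\<forall>e\<in>E. \<exists>a\<in>A. \<exists>b\<in>B. e = {a, b}"
    using bipartite unfolding graph_bipartite_def by blast
  \<comment> \<open>Here \<open>A\<close> is one colour class; each arc changes sides, so the parity
    of a walk is decided by its end points.\<close>
  have arc: "u \<in> A \<longleftrightarrow> v \<notin> A" if "(u, v) \<in> arcs E" for u v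
  proof -
    obtain a b where "a \<in> A" "b \<in> B" "{u, v} = {a, b}"
      using \<open>(u, v) \<in> arcs E\<close> AB(2) unfolding arcs_def by blast
    then show ?thesis using AB(1) by (auto simp: doubleton_eq_iff)
  qed
  have "even n \<longleftrightarrow> (u \<in> A \<longleftrightarrow> v \<in> A)" if "(u, v) \<in> arcs E ^^ n" for u v n
    using that
  proof (induction n arbitrary: v)
    case (Suc n)
    then obtain w where "(u, w) \<in> arcs E ^^ n" "(w, v) \<in> arcs E" by auto
    then show ?case using Suc.IH[of w] arc[of w v] by auto
  qed simp
  then show ?thesis by (rule that)
qed

text \<open>The triangle inequality bounds the difference by one, and parity excludes
  equality.\<close>

lemma dist_arc_cases:
  assumes "(u, v) \<in> arcs E" "w \<in> V"
  shows "\<delta> w v = \<delta> w u + 1 \<or> \<delta> w u = \<delta> w v + 1"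
proof -
  obtain A where A: "\<And>u v n. (u, v) \<in> arcs E ^^ n \<Longrightarrow> even n \<longleftrightarrow> (u \<in> A \<longleftrightarrow> v \<in> A)"
    using parity by blast
  have "even (\<delta> w u) \<longleftrightarrow> odd (\<delta> w v)"
    using A[OF dist_walk[of w u]] A[OF dist_walk[of w v]] A[of u v 1] assms arcD by auto
  then have "\<delta> w u \<noteq> \<delta> w v" by auto
  moreover have "\<delta> w v \<le> \<delta> w u + 1" "\<delta> w u \<le> \<delta> w v + 1"
    using assms dist_arc_le[of u v w] dist_arc_le[of v u w] arcs_sym[of u v] by simp_all
  ultimately show ?thesis by linarith
qed

abbreviation like :: "'a \<times> 'a \<Rightarrow> 'a \<times> 'a \<Rightarrow> bool" where
  "like a b \<equiv> (a, b) \<in> like_rel E"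

lemma like_iff:
  "like (s, t) (p, q) \<longleftrightarrow> (s, t) \<in> arcs E \<and> (p, q) \<in> arcs E \<and>
     \<delta> s p = \<delta> t q \<and> \<delta> s q = \<delta> s p + 1 \<and> \<delta> t p = \<delta> s p + 1"
  unfolding like_rel_def by auto

lemma like_refl: "(s, t) \<in> arcs E \<Longrightarrow> like (s, t) (s, t)"
  using dist_arc[of s t] graph_dist_commute[of E t s] by (simp add: like_iff)

lemma like_sym:
  assumes "like a b"
  shows "like b a"
proof -
  obtain s t p q where "a = (s, t)" "b = (p, q)" by (cases a; cases b)
  then show ?thesis
    using assms graph_dist_commute[of E p s] graph_dist_commute[of E p t]
      graph_dist_commute[of E q s] graph_dist_commute[of E q t]
    by (simp add: like_iff)
qed

lemma like_flip: "like (s, t) (p, q) \<longleftrightarrow> like (t, s) (q, p)"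
  using arcs_sym[of s t] arcs_sym[of p q] by (auto simp: like_iff)

text \<open>The distance between the tails is zero, so the like condition makes the distance between
  the heads zero too.\<close>

lemma like_same_tail:
  assumes "like (p, q) (p, r)"
  shows "q = r"
proof -
  have "q \<in> V" "r \<in> V" "\<delta> q r = 0"
    using assms arcD by (auto simp: like_iff)
  then show ?thesis using dist_eq_0 by blast
qed

text \<open>Along each side of the square \<open>a\<close>, \<open>b\<close>, \<open>p\<close>,
  \<open>q\<close> the distances change by exactly one. The two strict inequalities therefore
  determine all the equalities that likeness demands.\<close>

lemma like_iff_crossing:
  assumes ab: "(a, b) \<in> arcs E" and pq: "(p, q) \<in> arcs E"
  shows "like (a, b) (p, q) \<longleftrightarrow> \<delta> p a < \<delta> p b \<and> \<delta> q b < \<delta> q a"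
proof -
  have V: "a \<in> V" "b \<in> V" "p \<in> V" "q \<in> V" using ab pq arcD by auto
  have "like (a, b) (p, q) \<longleftrightarrow> \<delta> p a = \<delta> q b \<and> \<delta> q a = \<delta> p a + 1 \<and> \<delta> p b = \<delta> p a + 1"
    using ab pq graph_dist_commute[of E] by (metis like_iff)
  moreover have "\<delta> p b = \<delta> p a + 1 \<or> \<delta> p a = \<delta> p b + 1"
    "\<delta> q b = \<delta> q a + 1 \<or> \<delta> q a = \<delta> q b + 1"
    using dist_arc_cases[OF ab] V by blast+
  moreover have "\<delta> q a = \<delta> p a + 1 \<or> \<delta> p a = \<delta> q a + 1"
    "\<delta> q b = \<delta> p b + 1 \<or> \<delta> p b = \<delta> q b + 1"
    using dist_arc_cases[OF pq, of a] dist_arc_cases[OF pq, of b] V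
    by (simp_all add: graph_dist_commute[of E a] graph_dist_commute[of E b])
  ultimately show ?thesis by linarith
qed

section \<open>Tokens of a mediatic graph as classes of like arcs\<close>

abbreviation tok :: "'a \<times> 'a \<Rightarrow> 'a token" where "tok \<equiv> graph_token V E"

abbreviation toks :: "'a token set" where "toks \<equiv> tok ` arcs E"

text \<open>Transitivity makes the definite description meaningful: two candidates for the head give
  like arcs with the same tail \<open>p\<close>, so they coincide.\<close>

lemma tok_like:
  assumes "like a (p, q)"
  shows "tok a p = q"
proof -
  have pq: "(p, q) \<in> arcs E" using assms by (cases a) (simp add: like_iff)
  have "q' = q" if "like a (p, q')" for q'
    using that assms like_sym like_trans like_same_tail by (meson transD)
  then have "(THE q. (p, q) \<in> arcs E \<and> like a (p, q)) = q"
    using assms pq by blast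
  then show ?thesis
    using assms pq arcD unfolding graph_token_def by auto
qed

lemma like_tok:
  assumes "p \<in> V" "tok a p \<noteq> p"
  shows "like a (p, tok a p)"
proof -
  have "\<exists>q. like a (p, q)"
    using assms unfolding graph_token_def by (auto split: if_splits)
  then show ?thesis using tok_like by metis
qed

lemma tok_closed:
  assumes "p \<in> V"
  shows "tok a p \<in> V"
proof (cases "tok a p = p")
  case False
  then have "(p, tok a p) \<in> arcs E"
    using like_tok[OF assms False] by (cases a) (simp add: like_iff)
  then show ?thesis using arcD by blast
qed (use assms in simp)

lemma tok_arc: "(p, q) \<in> arcs E \<Longrightarrow> tok (p, q) p = q"
  by (simp add: like_refl tok_like)

text \<open>One direction evaluates both tokens at the tail of \<open>b\<close>, which
  \<open>tok b\<close> moves; for the other, like arcs have the same like class, and that class is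
  all that \<open>graph_token\<close> sees.\<close>

lemma tok_eq_iff:
  assumes "a \<in> arcs E" "b \<in> arcs E"
  shows "tok a = tok b \<longleftrightarrow> like a b"
proof
  obtain p q where b: "b = (p, q)" by (cases b)
  assume "tok a = tok b"
  then have "tok a p = q" "q \<noteq> p" "p \<in> V" using b assms tok_arc arcD by auto
  then show "like a b" using like_tok b by metis
next
  assume "like a b"
  then have *: "like a c \<longleftrightarrow> like b c" for c
    using like_trans like_sym by (meson transD)
  show "tok a = tok b" unfolding graph_token_def * by (rule refl)
qed

lemma token_system_toks:
  assumes "\<exists>s\<in>V. \<exists>t\<in>V. s \<noteq> t"
  shows "token_system V toks"
  unfolding token_system_def
proof (intro conjI ballI)
  show "\<exists>s\<in>V. \<exists>t\<in>V. s \<noteq> t" by (fact assms)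
  then obtain s t where "(s, t) \<in> (arcs E)\<^sup>*" "s \<noteq> t"
    using connected unfolding graph_connected_def by blast
  then show "toks \<noteq> {}" by (auto elim: converse_rtranclE)
next
  fix \<tau> assume "\<tau> \<in> toks"
  then obtain s t where st: "(s, t) \<in> arcs E" "\<tau> = tok (s, t)" by auto
  then have "\<tau> s \<noteq> (\<lambda>s\<in>V. s) s"
    using tok_arc arcD by auto
  moreover have "\<tau> \<in> V \<rightarrow>\<^sub>E V"
    using tok_closed st by (auto simp: graph_token_def[of V E])
  ultimately show "is_token V \<tau>"
    unfolding is_token_def by auto
qed

lemma adjacent_toks: "adjacent_to V toks p q \<longleftrightarrow> (p, q) \<in> arcs E"
proof
  assume "adjacent_to V toks p q"
  then obtain a where "p \<in> V" "tok a p = q" "q \<noteq> p" unfolding adjacent_to_def by auto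
  then have "like a (p, q)" using like_tok by metis
  then show "(p, q) \<in> arcs E" by (cases a) (simp add: like_iff)
next
  assume "(p, q) \<in> arcs E"
  then show "adjacent_to V toks p q"
    using tok_arc arcD unfolding adjacent_to_def by blast
qed

text \<open>Likeness survives flipping both arcs, and on distinct states the action of a token is
  exactly likeness.\<close>

lemma reverse_tok:
  assumes "(s, t) \<in> arcs E"
  shows "is_reverse V toks (tok (t, s)) (tok (s, t))"
  unfolding is_reverse_def
proof (intro conjI ballI impI)
  show "tok (t, s) \<in> toks" "tok (s, t) \<in> toks"
    using assms arcs_sym[of s t] by simp_all
next
  fix p q
  assume "p \<in> V" "q \<in> V" "adjacent_to V toks p q \<or> adjacent_to V toks q p"
  then have "p \<in> V" "q \<in> V" "p \<noteq> q" unfolding adjacent_to_def by auto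
  then have "tok (s, t) p = q \<longleftrightarrow> like (s, t) (p, q)" "tok (t, s) q = p \<longleftrightarrow> like (t, s) (q, p)"
    using like_tok tok_like by metis+
  then show "tok (s, t) p = q \<longleftrightarrow> tok (t, s) q = p"
    using like_flip[of s t p q] by simp
qed

lemma reverse_tok_iff:
  assumes "(s, t) \<in> arcs E"
  shows "is_reverse V toks \<tau> (tok (s, t)) \<longleftrightarrow> \<tau> = tok (t, s)"
proof -
  \<comment> \<open>The given arc supplies the two distinct states that a token system
    requires.\<close>
  have "token_system V toks"
    using assms arcD by (intro token_system_toks) blast
  then show ?thesis
    using is_reverse_unique reverse_tok[OF assms] by metis
qed

text \<open>The indicator of the side of the cut \<open>ab\<close> on which \<open>b\<close> lies changes exactly at the
  arcs like \<open>ab\<close> or \<open>ba\<close>.\<close>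

lemma walk_crossings:
  assumes ab: "(a, b) \<in> arcs E" and "walk toks s m v" "s \<in> V"
  shows "count_list m (tok (a, b)) + of_bool (\<delta> s b < \<delta> s a) =
         count_list m (tok (b, a)) + of_bool (\<delta> v b < \<delta> v a)"
  using assms(2,3)
proof (induction m arbitrary: s)
  case (Cons \<tau> m)
  obtain c where c: "c \<in> arcs E" "\<tau> = tok c" using Cons.prems by auto
  define t where "t = \<tau> s"
  have like: "like c (s, t)"
    using Cons.prems c like_tok by (simp add: t_def)
  then have st: "(s, t) \<in> arcs E" by (cases c) (simp add: like_iff)
  then have t: "t \<in> V" using arcD by blast
  have \<tau>: "\<tau> = tok (s, t)"
    using like c st tok_eq_iff by blast
  have ba: "(b, a) \<in> arcs E" using ab by (simp add: arcs_sym[of b])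
  have "\<tau> = tok (a, b) \<longleftrightarrow> \<delta> s a < \<delta> s b \<and> \<delta> t b < \<delta> t a"
    "\<tau> = tok (b, a) \<longleftrightarrow> \<delta> s b < \<delta> s a \<and> \<delta> t a < \<delta> t b"
    using like_iff_crossing[OF ab st] like_iff_crossing[OF ba st] \<tau>
      tok_eq_iff[OF ab st] tok_eq_iff[OF ba st] by auto
  \<comment> \<open>No vertex is equidistant from \<open>a\<close> and \<open>b\<close>, so the two
    sides of the cut are complementary and the cases are exhaustive.\<close>
  moreover have "\<delta> s a \<noteq> \<delta> s b" "\<delta> t a \<noteq> \<delta> t b"
    using dist_arc_cases[OF ab, of s] dist_arc_cases[OF ab, of t] Cons.prems t by auto
  moreover have "count_list m (tok (a, b)) + of_bool (\<delta> t b < \<delta> t a) =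
         count_list m (tok (b, a)) + of_bool (\<delta> v b < \<delta> v a)"
    using Cons t by (simp add: t_def)
  ultimately show ?case by auto
qed simp

lemma tok_neq_flip: "(a, b) \<in> arcs E \<Longrightarrow> tok (a, b) \<noteq> tok (b, a)"
  using tok_eq_iff[of "(a, b)" "(b, a)"] by (auto simp: like_iff arcs_sym[of b])

text \<open>A closed walk crosses every cut equally often both ways, so its tokens are balanced and
  \<open>balanced_pairing\<close> applies, with the passage to the reverse token as the
  involution.\<close>

lemma return_vacuous:
  assumes "walk toks s m s" "s \<in> V"
  shows "vacuous V toks m"
proof -
  \<comment> \<open>A representative arc for each token, so that the reverse can be written as a
    function \<open>r\<close> of the token alone. The next fact shows that the choice of arc does
    not matter, since flipping preserves likeness.\<close>
  define arc where "arc = inv_into (arcs E) tok"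
  have arc: "arc \<tau> \<in> arcs E \<and> tok (arc \<tau>) = \<tau>" if "\<tau> \<in> toks" for \<tau>
    unfolding arc_def using that by (simp add: inv_into_into f_inv_into_f)
  define r where "r \<tau> = tok (prod.swap (arc \<tau>))" for \<tau>
  have r: "r (tok (a, b)) = tok (b, a)" if "(a, b) \<in> arcs E" for a b
  proof -
    obtain p q where pq: "arc (tok (a, b)) = (p, q)" by fastforce
    then have "(p, q) \<in> arcs E" "tok (p, q) = tok (a, b)" using arc that by (metis imageI)+
    then have "like (p, q) (a, b)" using tok_eq_iff that by blast
    then have "like (q, p) (b, a)" using like_flip[of p q a b] by simp
    then have "tok (q, p) = tok (b, a)"
      using tok_eq_iff[of "(q, p)" "(b, a)"] by (simp add: like_iff)
    then show ?thesis using pq by (simp add: r_def)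
  qed
  have tok: "m ! i \<in> toks" if "i < length m" for i
    using assms walk_tokens that by (metis nth_mem subsetD)
  have "\<exists>P. partition_on {..<length m} P \<and> (\<forall>p\<in>P. \<exists>i\<in>{..<length m}. \<exists>j\<in>{..<length m}.
      p = {i, j} \<and> i \<noteq> j \<and> m ! j = r (m ! i))"
  proof (rule balanced_pairing)
    fix i assume "i \<in> {..<length m}"
    then obtain a b where ab: "(a, b) \<in> arcs E" "m ! i = tok (a, b)" using tok by fastforce
    then show "r (r (m ! i)) = m ! i" "r (m ! i) \<noteq> m ! i"
      using r[of a b] r[of b a] arcs_sym[of a b] tok_neq_flip[of a b] by auto
    show "card {j \<in> {..<length m}. m ! j = m ! i} = card {j \<in> {..<length m}. m ! j = r (m ! i)}"
      \<comment> \<open>Start and end agree, so the two indicator terms cancel.\<close>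
      using walk_crossings[OF ab(1) assms] ab r by (simp add: count_list_card)
  qed simp
  moreover have "is_reverse V toks (m ! i) (m ! j) \<and> is_reverse V toks (m ! j) (m ! i)"
    if "i < length m" "m ! j = r (m ! i)" for i j
  proof -
    obtain a b where "(a, b) \<in> arcs E" "m ! i = tok (a, b)" using tok \<open>i < length m\<close> by fastforce
    then show ?thesis using that r reverse_tok is_reverse_sym by metis
  qed
  ultimately show ?thesis
    unfolding vacuous_def by (metis lessThan_iff)
qed

text \<open>The distance equation says that each token comes from an arc \<open>ab\<close> on a
  geodesic from \<open>s\<close> to \<open>v\<close>, traversed from \<open>a\<close> to
  \<open>b\<close>. Carrying it through the induction shows that later steps never cross the cut of
  the first arc again.\<close>

lemma geodesic_message:
  assumes "s \<in> V" "v \<in> V"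
  shows "\<exists>m. walk toks s m v \<and> distinct m \<and>
    (\<forall>\<tau>\<in>set m. \<exists>a b. (a, b) \<in> arcs E \<and> \<tau> = tok (a, b) \<and> tok (b, a) \<notin> set m \<and>
       \<delta> s v = \<delta> s a + 1 + \<delta> b v)"
  using assms
proof (induction "\<delta> s v" arbitrary: s)
  case 0
  then show ?case using dist_eq_0 by (intro exI[of _ "[]"]) auto
next
  case (Suc n)
  then have "(s, v) \<in> arcs E ^^ Suc n" using dist_walk[of s v] by simp
  then obtain t where st: "(s, t) \<in> arcs E" and tv: "(t, v) \<in> arcs E ^^ n"
    by (rule relpow_Suc_E2)
  have t: "t \<in> V" using st arcD by blast
  have n: "n = \<delta> t v"
    using graph_dist_le[OF tv] dist_triangle[of s t v] dist_arc[OF st] Suc t by simp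
  then obtain m where m: "walk toks t m v" "distinct m" and
    geo: "\<forall>\<tau>\<in>set m. \<exists>a b. (a, b) \<in> arcs E \<and> \<tau> = tok (a, b) \<and> tok (b, a) \<notin> set m \<and>
       \<delta> t v = \<delta> t a + 1 + \<delta> b v"
    using Suc t by metis
  \<comment> \<open>If \<open>a\<close> or \<open>b\<close> were nearer to \<open>s\<close> than
    this, going through it would reach \<open>v\<close> in fewer than \<open>Suc n\<close>
    steps.\<close>
  have farther: "\<delta> s a = \<delta> t a + 1 \<and> \<delta> s b = \<delta> s a + 1"
    if ab: "(a, b) \<in> arcs E" and "\<delta> t v = \<delta> t a + 1 + \<delta> b v" for a b
  proof -
    have "a \<in> V" "b \<in> V" using arcD ab by auto
    then show ?thesis
      using dist_triangle[of s a v] dist_triangle[of s b v] dist_triangle[of a b v]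
        dist_triangle[of s t a] dist_triangle[of s a b] dist_arc[OF ab] dist_arc[OF st]
        Suc n t that
      by simp
  qed
  \<comment> \<open>Moving from \<open>s\<close> to \<open>t\<close> brings \<open>a\<close> one
    step nearer, against likeness of \<open>ab\<close> with \<open>st\<close>; likeness with
    \<open>ts\<close> would need \<open>b\<close> as far from \<open>s\<close> as \<open>a\<close>
    is from \<open>t\<close>, but it is two further.\<close>
  have new: "tok (a, b) \<noteq> tok (s, t) \<and> tok (a, b) \<noteq> tok (t, s)"
    if ab: "(a, b) \<in> arcs E" and "\<delta> t v = \<delta> t a + 1 + \<delta> b v" for a b
  proof -
    have "\<not> like (a, b) (s, t)" "\<not> like (a, b) (t, s)"
      using farther[OF that] by (auto simp: like_iff graph_dist_commute)
    then show ?thesis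
      using tok_eq_iff[OF ab, of "(s, t)"] tok_eq_iff[OF ab, of "(t, s)"] st arcs_sym[of s t] by auto
  qed
  have "walk toks s (tok (s, t) # m) v"
    using m st tok_arc[OF st] arcD by auto
  moreover have avoid: "tok (s, t) \<notin> set m \<and> tok (t, s) \<notin> set m"
    using geo new by metis
  then have "distinct (tok (s, t) # m)"
    using m by simp
  moreover have "\<exists>a b. (a, b) \<in> arcs E \<and> \<tau> = tok (a, b) \<and> tok (b, a) \<notin> set (tok (s, t) # m) \<and>
      \<delta> s v = \<delta> s a + 1 + \<delta> b v" if "\<tau> \<in> set (tok (s, t) # m)" for \<tau>
  proof (cases "\<tau> = tok (s, t)")
    case True
    have "tok (t, s) \<notin> set (tok (s, t) # m)" "\<delta> s v = \<delta> s s + 1 + \<delta> t v"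
      using avoid tok_neq_flip[OF st] Suc(2) n by auto
    then show ?thesis using True st by blast
  next
    case False
    then obtain a b where ab: "(a, b) \<in> arcs E" "\<tau> = tok (a, b)" "tok (b, a) \<notin> set m"
        "\<delta> t v = \<delta> t a + 1 + \<delta> b v"
      using geo \<open>\<tau> \<in> set (tok (s, t) # m)\<close> by auto
    \<comment> \<open>Equality would make \<open>ba\<close> like \<open>st\<close>, hence
      \<open>ab\<close> like \<open>ts\<close>, which \<open>new\<close> excludes.\<close>
    have "tok (b, a) \<noteq> tok (s, t)"
      using new[OF ab(1,4)] ab(1) st tok_eq_iff[of "(a, b)" "(t, s)"]
        tok_eq_iff[of "(b, a)" "(s, t)"] like_flip[of a b t s] arcs_sym[of a b] arcs_sym[of s t]
      by simp
    moreover have "\<delta> s v = \<delta> s a + 1 + \<delta> b v"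
      using farther[OF ab(1,4)] ab(4) Suc(2) n by simp
    ultimately show ?thesis using ab by auto
  qed
  ultimately show ?case by blast
qed

lemma medium_toks:
  assumes "\<exists>s\<in>V. \<exists>t\<in>V. s \<noteq> t"
  shows "medium V toks"
  unfolding medium_iff
proof (intro conjI ballI impI allI)
  fix s v assume "s \<in> V" "v \<in> V"
  then obtain m where m: "walk toks s m v" "distinct m" "\<forall>\<tau>\<in>set m. \<exists>a b. (a, b) \<in> arcs E \<and>
      \<tau> = tok (a, b) \<and> tok (b, a) \<notin> set m"
    using geodesic_message[of s v] by blast
  moreover from m(3) have "consistent V toks m"
    unfolding consistent_def using reverse_tok_iff by metis
  ultimately show "\<exists>m. walk toks s m v \<and> consistent V toks m \<and> distinct m" by blast
next
  show "token_system V toks" using assms by (rule token_system_toks)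
next
  show "vacuous V toks m" if "s \<in> V" "walk toks s m s" for m s
    using return_vacuous[OF that(2,1)] .
qed

end

section \<open>The graph of a medium\<close>

definition medium_edges :: "'a set \<Rightarrow> 'a token set \<Rightarrow> 'a set set" where
  "medium_edges S T = {{s, t} | s t. s \<in> S \<and> t \<in> S \<and> s \<noteq> t \<and> (\<exists>\<tau>\<in>T. \<tau> s = t)}"

locale medium_graph =
  fixes S :: "'a set" and T :: "'a token set"
  assumes medium: "medium S T"
begin

lemmas ts = medium[unfolded medium_iff, THEN conjunct1]
lemmas concise_ex = medium[unfolded medium_iff, THEN conjunct2, THEN conjunct1, rule_format]
lemmas return_vacuous = medium[unfolded medium_iff, THEN conjunct2, THEN conjunct2, rule_format]

section \<open>The tokens of a medium and their reverses\<close>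

lemma token_PiE: "\<tau> \<in> T \<Longrightarrow> \<tau> \<in> S \<rightarrow>\<^sub>E S"
  using ts unfolding token_system_def is_token_def by simp

lemma token_closed: "\<tau> \<in> T \<Longrightarrow> s \<in> S \<Longrightarrow> \<tau> s \<in> S"
  by (rule PiE_mem[OF token_PiE])

lemma token_moves:
  assumes "\<tau> \<in> T"
  shows "\<exists>s\<in>S. \<tau> s \<noteq> s"
proof (rule ccontr)
  have \<tau>: "\<tau> \<in> S \<rightarrow>\<^sub>E S" "\<tau> \<noteq> (\<lambda>s\<in>S. s)"
    using ts assms unfolding token_system_def is_token_def by simp_all
  assume "\<not> (\<exists>s\<in>S. \<tau> s \<noteq> s)"
  then have "\<tau> s = (\<lambda>s\<in>S. s) s" for s
    using PiE_arb[OF \<tau>(1)] by simp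
  then show False using \<tau>(2) by (simp add: ext)
qed

lemma walk_closed: "walk T s m v \<Longrightarrow> s \<in> S \<Longrightarrow> v \<in> S"
proof (induction m arbitrary: s)
  case (Cons \<tau> m)
  then show ?case using token_closed[of \<tau> s] Cons.IH[of "\<tau> s"] by simp
qed simp

lemma concise_walk:
  assumes "s \<in> S" "v \<in> S"
  obtains m where "walk T s m v" "consistent S T m" "distinct m"
proof (cases "s = v")
  case True
  then show ?thesis using that[of "[]"] by (simp add: consistent_def)
next
  case False
  then show ?thesis using that concise_ex[OF assms] by blast
qed

text \<open>Let \<open>\<tau>\<close> move \<open>s\<close> and come back by a concise message. The
  resulting return is vacuous, so the initial \<open>\<tau>\<close> is paired with a reverse
  occurring in the way back.\<close>

lemma reverse_exists:
  assumes "\<tau> \<in> T"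
  shows "\<exists>\<tau>'. is_reverse S T \<tau>' \<tau> \<and> \<tau>' \<noteq> \<tau>"
proof -
  obtain s where s: "s \<in> S" "\<tau> s \<noteq> s" using assms token_moves by blast
  obtain m where m: "walk T (\<tau> s) m s" "consistent S T m"
    using concise_walk[of "\<tau> s" s] s assms token_closed by blast
  have "vacuous S T (\<tau> # m)"
    using return_vacuous[of s "\<tau> # m"] m s assms by simp
  then obtain P where P: "partition_on {..<length (\<tau> # m)} P"
    "\<forall>p\<in>P. \<exists>i j. p = {i, j} \<and> i \<noteq> j \<and>
       is_reverse S T ((\<tau> # m) ! i) ((\<tau> # m) ! j) \<and> is_reverse S T ((\<tau> # m) ! j) ((\<tau> # m) ! i)"
    unfolding vacuous_def by blast
  have U: "{..<length (\<tau> # m)} = \<Union>P"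
    using P(1) by (rule partition_onD1)
  then have "0 \<in> \<Union>P" by auto
  then obtain p where p: "p \<in> P" "0 \<in> p" by blast
  then obtain i j where ij: "p = {i, j}" "i \<noteq> j" "is_reverse S T ((\<tau> # m) ! i) ((\<tau> # m) ! j)"
      "is_reverse S T ((\<tau> # m) ! j) ((\<tau> # m) ! i)"
    using P(2) by blast
  \<comment> \<open>The partner of position 0 in the pairing; being positive, it points into
    \<open>m\<close>.\<close>
  define k where "k = (if i = 0 then j else i)"
  have k: "k \<noteq> 0" "is_reverse S T ((\<tau> # m) ! k) \<tau>" "k \<in> \<Union>P"
    using ij p by (auto simp: k_def split: if_splits)
  then obtain l where l: "k = Suc l" "l < length m"
    unfolding U[symmetric] by (cases k) auto
  \<comment> \<open>Otherwise \<open>\<tau>\<close> would be its own reverse and would occur in the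
    consistent message \<open>m\<close>.\<close>
  have "m ! l \<noteq> \<tau>"
  proof
    assume eq: "m ! l = \<tau>"
    then have "\<tau> \<in> set m" using l nth_mem by blast
    moreover have "is_reverse S T \<tau> \<tau>" using k l eq by simp
    ultimately show False using m(2) unfolding consistent_def by blast
  qed
  then show ?thesis using k l by auto
qed

text \<open>For a token of \<open>T\<close> the choice is forced by
  \<open>is_reverse_unique\<close>; elsewhere the value is arbitrary, which is why the lemmas on
  \<open>rv\<close> assume membership in \<open>T\<close>.\<close>

definition rv :: "'a token \<Rightarrow> 'a token" where
  "rv \<tau> = (SOME \<tau>'. is_reverse S T \<tau>' \<tau>)"

lemma is_reverse_rv: "\<tau> \<in> T \<Longrightarrow> is_reverse S T (rv \<tau>) \<tau>"
  unfolding rv_def using reverse_exists by (metis someI_ex)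

lemma is_reverse_iff: "\<tau> \<in> T \<Longrightarrow> is_reverse S T \<tau>' \<tau> \<longleftrightarrow> \<tau>' = rv \<tau>"
  using is_reverse_rv is_reverse_unique[OF ts] by metis

lemma rv_in: "\<tau> \<in> T \<Longrightarrow> rv \<tau> \<in> T"
  using is_reverse_rv unfolding is_reverse_def by blast

lemma rv_rv: "\<tau> \<in> T \<Longrightarrow> rv (rv \<tau>) = \<tau>"
  using is_reverse_iff[of "rv \<tau>" \<tau>] is_reverse_sym[OF is_reverse_rv] rv_in by simp

lemma rv_neq: "\<tau> \<in> T \<Longrightarrow> rv \<tau> \<noteq> \<tau>"
  using reverse_exists is_reverse_iff by metis

lemma rv_eq_iff: "\<tau> \<in> T \<Longrightarrow> \<mu> \<in> T \<Longrightarrow> rv \<tau> = \<mu> \<longleftrightarrow> \<tau> = rv \<mu>"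
  using rv_rv by metis

lemma rv_undo:
  assumes "\<tau> \<in> T" "s \<in> S" "\<tau> s \<noteq> s"
  shows "rv \<tau> (\<tau> s) = s"
proof -
  have "adjacent_to S T s (\<tau> s)"
    using assms token_closed unfolding adjacent_to_def by auto
  then show ?thesis
    using is_reverse_rv[OF assms(1)] assms token_closed unfolding is_reverse_def by blast
qed

lemma consistentD: "consistent S T m \<Longrightarrow> \<tau> \<in> T \<Longrightarrow> \<tau> \<in> set m \<Longrightarrow> rv \<tau> \<notin> set m"
  using is_reverse_rv unfolding consistent_def by blast

section \<open>Net token counts and shortest messages\<close>

lemma walk_rev:
  assumes "s \<in> S" "walk T s m v"
  shows "walk T v (rev (map rv m)) s"
  using assms
proof (induction m arbitrary: s)
  case (Cons \<tau> m)
  then have "walk T v (rev (map rv m)) (\<tau> s)" "walk T (\<tau> s) [rv \<tau>] s"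
    using token_closed[of \<tau> s] rv_in[of \<tau>] rv_undo[of \<tau> s] by auto
  then show ?case by (simp only: list.map rev.simps walk_append) blast
qed simp

lemma count_map_rv:
  assumes "set m \<subseteq> T" "\<tau> \<in> T"
  shows "count_list (map rv m) \<tau> = count_list m (rv \<tau>)"
  using assms(1)
proof (induction m)
  case (Cons \<mu> m)
  then show ?case using rv_eq_iff[of \<mu> \<tau>] assms(2) by simp
qed simp

text \<open>The net number of occurrences of \<open>\<tau>\<close> depends only on the end points of a walk; the
  identity is arranged so that no subtraction occurs.\<close>

lemma walk_count:
  assumes "s \<in> S" "walk T s m v" "walk T s n v" "\<tau> \<in> T"
  shows "count_list m \<tau> + count_list n (rv \<tau>) = count_list m (rv \<tau>) + count_list n \<tau>"
proof -
  \<comment> \<open>Going out along \<open>m\<close> and back along the reversal of \<open>n\<close>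
    is a return, and a vacuous message has equal counts of a token and its reverse.\<close>
  have "walk T s (m @ rev (map rv n)) s"
    unfolding walk_append using assms(2) walk_rev[OF assms(1,3)] by blast
  then have "vacuous S T (m @ rev (map rv n))"
    using assms return_vacuous by blast
  from vacuous_count_eq[OF ts this is_reverse_rv[OF assms(4)]] show ?thesis
    using count_map_rv[OF walk_tokens[OF assms(3)] assms(4)] rv_rv[OF assms(4)]
      count_map_rv[OF walk_tokens[OF assms(3)] rv_in[OF assms(4)]]
    by simp
qed

text \<open>A token of \<open>m\<close> has positive net count there, because consistency excludes
  its reverse. The net count is the same in \<open>n\<close>, so the token must occur in
  \<open>n\<close>.\<close>

lemma concise_subset:
  assumes "s \<in> S" "walk T s m v" "consistent S T m" "walk T s n v"
  shows "set m \<subseteq> set n"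
proof
  fix \<tau> assume \<tau>: "\<tau> \<in> set m"
  then have T: "\<tau> \<in> T" using walk_tokens[OF assms(2)] by blast
  have "count_list m (rv \<tau>) = 0" "count_list m \<tau> \<noteq> 0"
    using \<tau> consistentD[OF assms(3) T] by (simp_all add: count_list_0_iff)
  then have "count_list n \<tau> \<noteq> 0"
    using walk_count[OF assms(1,2,4) T] by linarith
  then show "\<tau> \<in> set n" by (simp add: count_list_0_iff)
qed

lemma concise_shortest:
  assumes "s \<in> S" "walk T s m v" "consistent S T m" "distinct m" "walk T s n v"
  shows "length m \<le> length n"
proof -
  have "length m = card (set m)" using assms by (simp add: distinct_card)
  also have "\<dots> \<le> card (set n)" using concise_subset[OF assms(1,2,3,5)] by (simp add: card_mono)
  also have "\<dots> \<le> length n" by (rule card_length)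
  finally show ?thesis .
qed

text \<open>Compare with a concise message \<open>m\<close> between the same states: its tokens all
  occur in \<open>n\<close>, and the length bound leaves room for no others and no repetition.
  Consistency depends only on the set of tokens, so it passes from \<open>m\<close> to
  \<open>n\<close>.\<close>

lemma shortest_concise:
  assumes "s \<in> S" "walk T s n v" "\<And>m. walk T s m v \<Longrightarrow> length n \<le> length m"
  shows "consistent S T n \<and> distinct n"
proof -
  have "v \<in> S" using walk_closed assms by blast
  then obtain m where m: "walk T s m v" "consistent S T m" "distinct m"
    using concise_walk[OF assms(1)] by blast
  have sub: "set m \<subseteq> set n" using concise_subset m assms by blast
  have "card (set n) \<le> card (set m)"
    using card_length[of n] assms(3)[OF m(1)] distinct_card[OF m(3)] by linarith
  then have eq: "set m = set n" using sub by (meson List.finite_set card_seteq)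
  then have "card (set n) = length n"
    using card_length[of n] assms(3)[OF m(1)] distinct_card[OF m(3)] by simp
  then show ?thesis
    using m(2) eq card_distinct unfolding consistent_def by auto
qed

section \<open>Distances in the graph of a medium\<close>

abbreviation E :: "'a set set" where "E \<equiv> medium_edges S T"

text \<open>\<open>medium_edges\<close> asks for a token in one direction only; its reverse acts in
  the other.\<close>

lemma arc_iff: "(s, t) \<in> arcs E \<longleftrightarrow> s \<in> S \<and> s \<noteq> t \<and> (\<exists>\<tau>\<in>T. \<tau> s = t)"
proof
  assume "(s, t) \<in> arcs E"
  then obtain u v \<tau> where "{s, t} = {u, v}" "u \<in> S" "v \<in> S" "u \<noteq> v" "\<tau> \<in> T" "\<tau> u = v"
    unfolding arcs_def medium_edges_def by blast
  then show "s \<in> S \<and> s \<noteq> t \<and> (\<exists>\<tau>\<in>T. \<tau> s = t)"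
    using rv_undo rv_in by (metis doubleton_eq_iff)
next
  assume "s \<in> S \<and> s \<noteq> t \<and> (\<exists>\<tau>\<in>T. \<tau> s = t)"
  then show "(s, t) \<in> arcs E"
    unfolding arcs_def medium_edges_def using token_closed by blast
qed

text \<open>Effective steps of tokens are exactly arcs, so graph distances can be computed with
  messages.\<close>

lemma relpow_arcs_iff: "s \<in> S \<Longrightarrow> (s, v) \<in> arcs E ^^ n \<longleftrightarrow> (\<exists>m. walk T s m v \<and> length m = n)"
proof (induction n arbitrary: s)
  case (Suc n)
  have "(s, v) \<in> arcs E ^^ Suc n \<longleftrightarrow> (\<exists>t. (s, t) \<in> arcs E \<and> (t, v) \<in> arcs E ^^ n)"
    by (meson relpow_Suc_D2 relpow_Suc_I2)
  also have "\<dots> \<longleftrightarrow> (\<exists>\<tau>\<in>T. \<tau> s \<noteq> s \<and> (\<tau> s, v) \<in> arcs E ^^ n)"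
    unfolding arc_iff using Suc.prems by metis
  also have "\<dots> \<longleftrightarrow> (\<exists>\<tau>\<in>T. \<tau> s \<noteq> s \<and> (\<exists>m. walk T (\<tau> s) m v \<and> length m = n))"
    using Suc token_closed by blast
  also have "\<dots> \<longleftrightarrow> (\<exists>\<tau> m. walk T s (\<tau> # m) v \<and> length m = n)"
    unfolding walk_Cons by blast
  also have "\<dots> \<longleftrightarrow> (\<exists>m. walk T s m v \<and> length m = Suc n)"
    by (metis length_Suc_conv)
  finally show ?case .
qed auto

sublocale connected_graph S E
proof
  show "loopless_graph S E"
    unfolding loopless_graph_def medium_edges_def by blast
  show "graph_connected S E"
    unfolding graph_connected_def using concise_walk relpow_arcs_iff rtrancl_power by metis
qed

lemma dist_le_walk:
  assumes "s \<in> S" "walk T s m v"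
  shows "\<delta> s v \<le> length m"
proof (rule graph_dist_le)
  show "(s, v) \<in> arcs E ^^ length m"
    unfolding relpow_arcs_iff[OF assms(1)] using assms(2) by blast
qed

lemma shortest_walk:
  assumes "s \<in> S" "v \<in> S"
  obtains m where "walk T s m v" "length m = \<delta> s v"
  using dist_walk[OF assms] relpow_arcs_iff[OF assms(1), of v "\<delta> s v"] by blast

text \<open>This turns questions of consistency into comparisons of lengths with distances, the
  method of all that follows on the like relation.\<close>

lemma concise_iff:
  assumes "s \<in> S" "walk T s m v"
  shows "consistent S T m \<and> distinct m \<longleftrightarrow> length m = \<delta> s v"
proof -
  have "v \<in> S" using assms walk_closed by blast
  then obtain n where n: "walk T s n v" "length n = \<delta> s v"
    using shortest_walk[OF assms(1)] by blast
  have *: "\<delta> s v \<le> length k" if "walk T s k v" for k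
    using dist_le_walk[OF assms(1) that] .
  show ?thesis
  proof
    assume "consistent S T m \<and> distinct m"
    then show "length m = \<delta> s v"
      using concise_shortest[OF assms _ _ n(1)] n(2) *[OF assms(2)] by simp
  next
    assume "length m = \<delta> s v"
    then show "consistent S T m \<and> distinct m"
      using shortest_concise[OF assms] * by simp
  qed
qed

lemma closed_walk_even:
  assumes "s \<in> S" "(s, s) \<in> arcs E ^^ n"
  shows "even n"
proof -
  obtain m where m: "walk T s m s" "length m = n"
    using relpow_arcs_iff[OF assms(1)] assms(2) by blast
  show ?thesis
    using vacuous_even_length[OF return_vacuous[OF assms(1) m(1)]] m(2) by simp
qed

lemma bipartite_edges: "graph_bipartite S E"
proof -
  obtain r where r: "r \<in> S" using ts unfolding token_system_def by blast
  define A B where "A = {s \<in> S. even (\<delta> r s)}" and "B = {s \<in> S. odd (\<delta> r s)}"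
  have "\<exists>a\<in>A. \<exists>b\<in>B. e = {a, b}" if "e \<in> E" for e
  proof -
    obtain s t where st: "s \<in> S" "t \<in> S" "e = {s, t}"
      using \<open>e \<in> E\<close> loopless unfolding loopless_graph_def by blast
    then have arc: "(s, t) \<in> arcs E" using \<open>e \<in> E\<close> by (simp add: arcs_def)
    have "(r, t) \<in> arcs E ^^ Suc (\<delta> r s)"
      using dist_walk[OF r st(1)] arc by (rule relpow_Suc_I)
    \<comment> \<open>Geodesics from \<open>r\<close> to \<open>s\<close> and from \<open>t\<close>
      to \<open>r\<close> close up through the edge; the closed walk is even, so the classes by
      distance parity from the root \<open>r\<close> form a bipartition.\<close>
    then have "(r, r) \<in> arcs E ^^ (Suc (\<delta> r s) + \<delta> t r)"
      unfolding relpow_add using dist_walk[OF st(2) r] by (rule relcompI)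
    then have "even (Suc (\<delta> r s) + \<delta> t r)"
      by (rule closed_walk_even[OF r])
    then have "even (\<delta> r s) \<longleftrightarrow> odd (\<delta> r t)"
      using graph_dist_commute[of E t r] by simp
    then have "s \<in> A \<and> t \<in> B \<or> t \<in> A \<and> s \<in> B"
      using st unfolding A_def B_def by simp
    moreover have "e = {t, s}" using st(3) by (simp add: insert_commute)
    ultimately show ?thesis using st(3) by metis
  qed
  moreover have "A \<union> B = S" "A \<inter> B = {}" unfolding A_def B_def by auto
  ultimately show ?thesis unfolding graph_bipartite_def by metis
qed

section \<open>Arcs are like exactly when the same token induces them\<close>

lemma consistent_iff:
  assumes "set m \<subseteq> T"
  shows "consistent S T m \<longleftrightarrow> (\<forall>\<tau>\<in>set m. rv \<tau> \<notin> set m)"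
proof -
  have "is_reverse S T \<tau>' \<tau> \<longleftrightarrow> \<tau>' = rv \<tau>" if "\<tau> \<in> set m" for \<tau> \<tau>'
    using assms that by (intro is_reverse_iff) blast
  then show ?thesis unfolding consistent_def by simp
qed

text \<open>Otherwise a concise message from \<open>\<tau> s\<close> to \<open>p\<close> would contain the reverse of \<open>\<tau>\<close> twice.\<close>

lemma reverse_notin_concise:
  assumes \<tau>: "\<tau> \<in> T" and s: "s \<in> S" "\<tau> s \<noteq> s"
    and m: "walk T s m p" "consistent S T m"
  shows "rv \<tau> \<notin> set m"
proof
  assume r: "rv \<tau> \<in> set m"
  obtain n where n: "walk T (\<tau> s) n p" "distinct n"
    using concise_walk[OF token_closed[OF \<tau> s(1)] walk_closed[OF m(1) s(1)]] by blast
  have "\<tau> \<notin> set m"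
    using r consistentD[OF m(2) rv_in[OF \<tau>]] rv_rv[OF \<tau>] by simp
  then have "count_list m \<tau> = 0" by simp
  moreover have "count_list m (rv \<tau>) \<noteq> 0" using r by (simp add: count_list_0_iff)
  moreover have "walk T s (\<tau> # n) p" using n \<tau> s by simp
  then have "count_list m \<tau> + count_list (\<tau> # n) (rv \<tau>) =
      count_list m (rv \<tau>) + count_list (\<tau> # n) \<tau>"
    using walk_count[OF s(1) m(1) _ \<tau>] by blast
  moreover have "count_list n (rv \<tau>) \<le> 1"
    using n(2) by (rule count_list_le_1)
  ultimately show False
    using rv_neq[OF \<tau>] by simp
qed

text \<open>A concise message from \<open>s\<close> to \<open>p\<close> stays concise when
  \<open>\<tau>\<close> is appended, since neither \<open>\<tau>\<close> nor its reverse occurs in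
  it; its length is then the distance.\<close>

lemma token_farther:
  assumes \<tau>: "\<tau> \<in> T" and s: "s \<in> S" "\<tau> s \<noteq> s" and p: "p \<in> S" "\<tau> p \<noteq> p"
  shows "\<delta> s (\<tau> p) = \<delta> s p + 1"
proof -
  obtain m where m: "walk T s m p" "consistent S T m" "distinct m"
    using concise_walk[OF s(1) p(1)] by blast
  then have len: "length m = \<delta> s p" using concise_iff[OF s(1) m(1)] by blast
  have tokens: "set m \<subseteq> T" using walk_tokens[OF m(1)] .
  \<comment> \<open>The reversed message is concise because its length is the distance, so it avoids
    \<open>rv \<tau>\<close>. Translated back, \<open>m\<close> avoids
    \<open>\<tau>\<close>.\<close>
  have "walk T p (rev (map rv m)) s" using walk_rev[OF s(1) m(1)] .
  moreover from concise_iff[OF p(1) this] have "consistent S T (rev (map rv m))"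
    using len graph_dist_commute[of E s p] by simp
  ultimately have "rv \<tau> \<notin> set (rev (map rv m))"
    by (rule reverse_notin_concise[OF \<tau> p])
  then have new: "\<tau> \<notin> set m" using imageI[of \<tau> "set m" rv] by auto
  have new': "rv \<tau> \<notin> set m" using reverse_notin_concise[OF \<tau> s m(1,2)] .
  have "rv \<mu> \<notin> set (m @ [\<tau>])" if "\<mu> \<in> set (m @ [\<tau>])" for \<mu>
  proof (cases "\<mu> = \<tau>")
    case True
    then show ?thesis using new' rv_neq[OF \<tau>] by simp
  next
    case False
    then have \<mu>: "\<mu> \<in> set m" "\<mu> \<in> T" using that tokens by auto
    then have "rv \<mu> \<noteq> \<tau>" using rv_rv[OF \<mu>(2)] new' by metis
    then show ?thesis using consistentD[OF m(2) \<mu>(2,1)] by simp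
  qed
  then have "consistent S T (m @ [\<tau>])"
    using consistent_iff[of "m @ [\<tau>]"] tokens \<tau> by simp
  moreover have "distinct (m @ [\<tau>])" using m(3) new by simp
  moreover have "walk T s (m @ [\<tau>]) (\<tau> p)"
    unfolding walk_append using m(1) \<tau> p(2) by (intro exI[of _ p]) simp
  ultimately have "length (m @ [\<tau>]) = \<delta> s (\<tau> p)" using concise_iff[OF s(1)] by metis
  then show ?thesis using len by simp
qed

text \<open>Apply \<open>token_farther\<close> to \<open>\<tau>\<close> with \<open>s\<close> and
  \<open>p\<close> in both orders, and to the reverse token at their images.\<close>

lemma token_like:
  assumes \<tau>: "\<tau> \<in> T" and s: "s \<in> S" "\<tau> s \<noteq> s" and p: "p \<in> S" "\<tau> p \<noteq> p"
  shows "((s, \<tau> s), (p, \<tau> p)) \<in> like_rel E"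
proof -
  have "\<delta> (\<tau> s) (rv \<tau> (\<tau> p)) = \<delta> (\<tau> s) (\<tau> p) + 1"
    using token_farther[OF rv_in[OF \<tau>], of "\<tau> s" "\<tau> p"] rv_undo[OF \<tau>] token_closed[OF \<tau>] s p
    by auto
  then have "\<delta> (\<tau> s) p = \<delta> (\<tau> s) (\<tau> p) + 1"
    using rv_undo[OF \<tau> p] by simp
  moreover have "\<delta> s (\<tau> p) = \<delta> s p + 1" "\<delta> p (\<tau> s) = \<delta> p s + 1"
    using token_farther[OF \<tau> s p] token_farther[OF \<tau> p s] by simp_all
  moreover have "(s, \<tau> s) \<in> arcs E" "(p, \<tau> p) \<in> arcs E"
    unfolding arc_iff using \<tau> s p by metis+
  ultimately show ?thesis
    using graph_dist_commute[of E p "\<tau> s"] graph_dist_commute[of E p s]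
    unfolding like_rel_def by simp
qed

text \<open>Likeness yields two shortest walks from \<open>s\<close> to \<open>q\<close>, one ending
  with \<open>\<mu>\<close> and one starting with \<open>\<tau>\<close>, so \<open>\<tau>\<close>
  occurs in the first. It is not in the part \<open>m\<close> before \<open>\<mu>\<close>, because
  \<open>rv \<tau> # m\<close> is a shortest walk from \<open>t\<close> to \<open>p\<close> and
  hence consistent.\<close>

lemma like_token:
  assumes like: "((s, t), (p, q)) \<in> like_rel E"
    and \<tau>: "\<tau> \<in> T" "\<tau> s = t" and \<mu>: "\<mu> \<in> T" "\<mu> p = q"
  shows "\<tau> = \<mu>"
proof -
  have arcs: "(s, t) \<in> arcs E" "(p, q) \<in> arcs E" and
    dist: "\<delta> t q = \<delta> s p" "\<delta> s q = \<delta> s p + 1" "\<delta> t p = \<delta> s p + 1"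
    using like unfolding like_rel_def by auto
  then have S: "s \<in> S" "t \<in> S" "p \<in> S" "q \<in> S" "s \<noteq> t" "p \<noteq> q" using arcD by auto
  obtain m where m: "walk T s m p" "length m = \<delta> s p"
    using shortest_walk S by blast
  obtain n where n: "walk T t n q" "length n = \<delta> t q"
    using shortest_walk S by blast
  have 1: "walk T s (m @ [\<mu>]) q" "length (m @ [\<mu>]) = \<delta> s q"
    using m \<mu> S dist unfolding walk_append by auto
  have 2: "walk T s (\<tau> # n) q" "length (\<tau> # n) = \<delta> s q"
    using n \<tau> S dist by auto
  have "set (\<tau> # n) \<subseteq> set (m @ [\<mu>])"
    using concise_subset[OF S(1) 2(1) _ 1(1)] concise_iff[OF S(1) 2(1)] 2(2) by blast
  moreover have "\<tau> \<notin> set m"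
  proof -
    have "walk T t (rv \<tau> # m) p" "length (rv \<tau> # m) = \<delta> t p"
      using m \<tau> rv_in rv_undo[OF \<tau>(1) S(1)] S dist by auto
    then have "consistent S T (rv \<tau> # m)"
      using concise_iff[OF S(2)] by blast
    then show ?thesis
      using consistentD[of "rv \<tau> # m" \<tau>] \<tau> by auto
  qed
  ultimately show ?thesis by auto
qed

lemma arc_token:
  assumes "(s, t) \<in> arcs E"
  obtains \<tau> where "\<tau> \<in> T" "\<tau> s = t"
  using assms arc_iff by blast

lemma like_transitive: "trans (like_rel E)"
proof (rule transI)
  fix a b c assume *: "(a, b) \<in> like_rel E" "(b, c) \<in> like_rel E"
  obtain s t p q x y where abc: "a = (s, t)" "b = (p, q)" "c = (x, y)"
    by (cases a; cases b; cases c)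
  have arcs: "(s, t) \<in> arcs E" "(p, q) \<in> arcs E" "(x, y) \<in> arcs E"
    using * abc unfolding like_rel_def by auto
  obtain \<tau> where \<tau>: "\<tau> \<in> T" "\<tau> s = t" using arc_token arcs by metis
  obtain \<mu> where \<mu>: "\<mu> \<in> T" "\<mu> p = q" using arc_token arcs by metis
  obtain \<nu> where \<nu>: "\<nu> \<in> T" "\<nu> x = y" using arc_token arcs by metis
  have "\<tau> = \<mu>" "\<mu> = \<nu>"
    using * abc like_token \<tau> \<mu> \<nu> by metis+
  then show "(a, c) \<in> like_rel E"
    using token_like[OF \<tau>(1), of s x] \<tau> \<nu> abc arcs arcD by metis
qed

section \<open>Recovering the medium from its graph\<close>

sublocale mediatic S E
  by unfold_locales (rule bipartite_edges like_transitive)+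

text \<open>Where \<open>\<tau>\<close> moves \<open>p\<close>, \<open>token_like\<close> decides.
  If \<open>\<tau>\<close> fixed \<open>p\<close> but the graph token moved it, the token inducing
  that arc would equal \<open>\<tau>\<close> by \<open>like_token\<close>. Outside \<open>S\<close>
  both are \<open>undefined\<close>.\<close>

lemma tok_eq_token:
  assumes \<tau>: "\<tau> \<in> T" and st: "(s, t) \<in> arcs E" "\<tau> s = t"
  shows "tok (s, t) = \<tau>"
proof (rule ext)
  fix p
  have s: "s \<in> S" "\<tau> s \<noteq> s" using arcD[OF st(1)] st(2) by auto
  consider "p \<in> S" "\<tau> p \<noteq> p" | "p \<in> S" "\<tau> p = p" | "p \<notin> S" by blast
  then show "tok (s, t) p = \<tau> p"
  proof cases
    case 1
    then show ?thesis using token_like[OF \<tau> s] st tok_like by simp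
  next
    case 2
    have "tok (s, t) p = p"
    proof (rule ccontr)
      assume "tok (s, t) p \<noteq> p"
      then have like: "like (s, t) (p, tok (s, t) p)" using like_tok 2 by blast
      then have "(p, tok (s, t) p) \<in> arcs E" by (simp add: like_iff)
      then obtain \<mu> where "\<mu> \<in> T" "\<mu> p = tok (s, t) p" by (rule arc_token)
      then show False
        using like_token[OF like \<tau> st(2)] 2 \<open>tok (s, t) p \<noteq> p\<close> by metis
    qed
    then show ?thesis using 2 by simp
  next
    case 3
    then show ?thesis
      using PiE_arb[OF token_PiE[OF \<tau>]] by (simp add: graph_token_def)
  qed
qed

lemma toks_eq: "toks = T"
proof
  show "toks \<subseteq> T"
  proof (rule image_subsetI)
    fix a assume a: "a \<in> arcs E"
    obtain s t where st: "a = (s, t)" by (cases a)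
    then obtain \<tau> where "\<tau> \<in> T" "\<tau> s = t" using a arc_token by metis
    then show "tok a \<in> T" using tok_eq_token a st by simp
  qed
  show "T \<subseteq> toks"
  proof
    fix \<tau> assume \<tau>: "\<tau> \<in> T"
    then obtain s where "s \<in> S" "\<tau> s \<noteq> s" using token_moves by blast
    then have "(s, \<tau> s) \<in> arcs E" using \<tau> by (auto simp: arc_iff)
    then show "\<tau> \<in> toks" using tok_eq_token[OF \<tau>] by (metis imageI)
  qed
qed

lemma mediatic_edges: "mediatic_graph S E"
  unfolding mediatic_graph_def using loopless connected bipartite_edges like_transitive by blast

lemma is_graph_of_edges: "is_graph_of (S, T) (S, E)"
proof -
  have "{s, t} \<in> E \<longleftrightarrow> (\<exists>\<tau>\<in>T. \<tau> s = t)" if "s \<in> S" "s \<noteq> t" for s t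
    using arc_iff[of s t] that by (simp add: arcs_def)
  then show ?thesis using loopless by simp
qed

end

section \<open>The two constructions are mutually inverse\<close>

lemma (in mediatic) medium_edges_toks: "medium_edges V toks = E"
proof -
  have "medium_edges V toks = {{s, t} | s t. adjacent_to V toks s t}"
    unfolding medium_edges_def adjacent_to_def by blast
  also have "\<dots> = {{s, t} | s t. (s, t) \<in> arcs E}"
    by (simp add: adjacent_toks)
  also have "\<dots> = E"
    using loopless unfolding loopless_graph_def by (fastforce simp: arcs_def)
  finally show ?thesis .
qed

lemma mediatic_graph_imp_mediatic: "mediatic_graph V E \<Longrightarrow> mediatic V E"
  unfolding mediatic_graph_def by unfold_locales auto

theorem theorem36:
  fixes S :: "'a set"
  assumes "\<exists>s\<in>S. \<exists>t\<in>S. s \<noteq> t"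
  shows "\<exists>f :: 'a set \<times> ('a \<Rightarrow> 'a) set \<Rightarrow> 'a set \<times> 'a set set.
    bij_betw f (media_on S) (mediatic_graphs_on S) \<and>
    (\<forall>M\<in>media_on S. is_graph_of M (f M)) \<and>
    (\<forall>M\<in>media_on S. \<forall>G\<in>mediatic_graphs_on S.
       (G = f M \<and> is_graph_of M G) \<longleftrightarrow> M = medium_of_graph G)"
proof (intro exI conjI ballI)
  \<comment> \<open>The inverse witness for the bijection is \<open>medium_of_graph\<close>; the
    facts \<open>f\<close> and \<open>g\<close> give the two compositions, and these also yield the
    final equivalence.\<close>
  let ?f = "\<lambda>(S, T). (S, medium_edges S T)"
  have f: "?f M \<in> mediatic_graphs_on S" "is_graph_of M (?f M)" "medium_of_graph (?f M) = M"
    if M: "M \<in> media_on S" for M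
  proof -
    obtain T where T: "M = (S, T)" "medium S T" using M unfolding media_on_def by blast
    interpret medium_graph S T using T(2) by unfold_locales
    show "?f M \<in> mediatic_graphs_on S" "is_graph_of M (?f M)" "medium_of_graph (?f M) = M"
      using mediatic_edges is_graph_of_edges toks_eq T(1) by (auto simp: mediatic_graphs_on_def)
  qed
  have g: "medium_of_graph G \<in> media_on S" "?f (medium_of_graph G) = G"
    if G: "G \<in> mediatic_graphs_on S" for G
  proof -
    obtain E where E: "G = (S, E)" "mediatic_graph S E"
      using G unfolding mediatic_graphs_on_def by blast
    interpret mediatic S E using E(2) by (rule mediatic_graph_imp_mediatic)
    show "medium_of_graph G \<in> media_on S" "?f (medium_of_graph G) = G"
      using medium_toks[OF assms] medium_edges_toks E(1) by (auto simp: media_on_def)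
  qed
  show "bij_betw ?f (media_on S) (mediatic_graphs_on S)"
    using f g by (intro bij_betw_byWitness[where f' = medium_of_graph]) blast+
  show "is_graph_of M (?f M)" if "M \<in> media_on S" for M
    using f that by blast
  show "(G = ?f M \<and> is_graph_of M G) \<longleftrightarrow> M = medium_of_graph G"
    if "M \<in> media_on S" "G \<in> mediatic_graphs_on S" for M G
    using f(2,3)[OF that(1)] g(2)[OF that(2)] by auto
qed

end
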